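(* Let $\mathcal{F}=\{f_i(x)\}_{i=1}^m$ be a generalized interlacing family of polynomials with positive leading coefficients, and let $f_{\emptyset}(x)$ be the polynomial labelling the root of the associated tree. Then there exists $j\in[m]$ such that $\deg(f_j)=\deg(f_\emptyset)$ and $$\mathrm{minroot}\ f_j(x)\ \ge\ \mathrm{minroot}\ f_\emptyset(x).$$
   Context: $\mathrm{minroot}\,f$ is the smallest root of a nonconstant real-rooted polynomial $f$; it is understood that $\deg(f_\emptyset)\ge1$. $\lambda_i(f)$ is the $i$-th largest root of a real-rooted polynomial. Interlacing: let $f,g$ be real-rooted with positive leading coefficients, $\deg f=d$. We say $f$ interlaces $g$ if $\deg g\in\{d,d-1\}$ and: if $\deg g=d$, then $\lambda_1(f)\ge\lambda_1(g)\ge\lambda_2(f)\ge\lambda_2(g)\ge\cdots\ge\lambda_d(f)\ge\lambda_d(g)$; if $\deg g=d-1$, then $\lambda_1(f)\ge\lambda_1(g)\ge\lambda_2(f)\ge\cdots\ge\lambda_{d-1}(f)\ge\lambda_{d-1}(g)\ge\lambda_d(f)$. Real-rooted polynomials $p_1,\dots,p_m$ with positive leading coefficients have a common interlacing if some polynomial $f$ interlaces every $p_i$. Generalized interlacing family: a finite rooted tree $T$ together with a labelling of each node $v$ by a polynomial $f_v(x)\in\mathbb{R}[x]$ that is either identically zero or real-rooted with positive leading coefficient, such that (i) for every non-leaf node $v$, $f_v$ is a convex combination of the polynomials labelling its children; (ii) the degree of the root label $f_\emptyset$ equals the maximal degree of the polynomials labelling the leaf nodes; (iii) for any non-leaf node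 $v$ with $\deg(f_v)=\deg(f_\emptyset)$, the nonzero polynomials labelling the children of $v$ have degree $\deg(f_\emptyset)$ or $\deg(f_\emptyset)-1$, and they have a common interlacing. A set of polynomials forms a generalized interlacing family if it is the set of polynomials labelling the leaf nodes of such a tree. *)

theory Defs
  imports "HOL-Computational_Algebra.Computational_Algebra"
begin

definition real_rooted :: "real poly \<Rightarrow> bool" where
  "real_rooted p \<longleftrightarrow>
     p \<noteq> 0 \<and> (\<forall>z::complex. poly (map_poly complex_of_real p) z = 0 \<longrightarrow> z \<in> \<real>)"

text \<open>The \<open>i\<close>-th largest real root, counted with multiplicity; the index \<open>i\<close> starts at 1.\<close>

definition ith_largest_root :: "real poly \<Rightarrow> nat \<Rightarrow> real" where
  "ith_largest_root p i = rev (sorted_list_of_multiset (proots p)) ! (i - 1)"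

definition minroot :: "real poly \<Rightarrow> real" where
  "minroot p = Min {x. poly p x = 0}"

text \<open>The second disjunct says \<open>degree g = degree f - 1\<close> without truncated subtraction.\<close>

definition interlaces :: "real poly \<Rightarrow> real poly \<Rightarrow> bool" where
  "interlaces f g \<longleftrightarrow>
     real_rooted f \<and> lead_coeff f > 0 \<and> real_rooted g \<and> lead_coeff g > 0 \<and>
     (degree g = degree f \<and>
        (\<forall>i\<in>{1..degree f}. ith_largest_root f i \<ge> ith_largest_root g i) \<and>
        (\<forall>i\<in>{1..<degree f}. ith_largest_root g i \<ge> ith_largest_root f (i + 1))
      \<or> degree g + 1 = degree f \<and>
        (\<forall>i\<in>{1..<degree f}. ith_largest_root f i \<ge> ith_largest_root g i \<and> ith_largest_root g i \<ge> ith_largest_root f (i + 1)))"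

definition common_interlacing :: "real poly set \<Rightarrow> bool" where
  "common_interlacing P \<longleftrightarrow> (\<exists>f. \<forall>p\<in>P. interlaces f p)"

datatype 'a rose_tree = Node (label: 'a) (children: "'a rose_tree list")

text \<open>A node is identified with the subtree below it.\<close>

fun nodes :: "'a rose_tree \<Rightarrow> 'a rose_tree set" where
  "nodes (Node a ts) = insert (Node a ts) (\<Union>t\<in>set ts. nodes t)"

definition leaf_labels :: "'a rose_tree \<Rightarrow> 'a set" where
  "leaf_labels T = label ` {v \<in> nodes T. children v = []}"

definition convex_combination :: "real poly \<Rightarrow> real poly list \<Rightarrow> bool" where
  "convex_combination p ps \<longleftrightarrow>
     (\<exists>w :: nat \<Rightarrow> real. (\<forall>i<length ps. w i \<ge> 0) \<and> (\<Sum>i<length ps. w i) = 1 \<and>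
        p = (\<Sum>i<length ps. smult (w i) (ps ! i)))"

text \<open>
  Since \<open>degree 0 = 0\<close> here, the degree conditions below do not tell the zero polynomial from a
  nonzero constant. This is immaterial when the root label has degree at least 1, which is
  understood whenever \<open>minroot\<close> of the root label is considered.
\<close>

definition generalized_interlacing_tree :: "real poly rose_tree \<Rightarrow> bool" where
  "generalized_interlacing_tree T \<longleftrightarrow>
     (\<forall>v\<in>nodes T. label v = 0 \<or> real_rooted (label v) \<and> lead_coeff (label v) > 0) \<and>
     (\<forall>v\<in>nodes T. children v \<noteq> [] \<longrightarrow> convex_combination (label v) (map label (children v))) \<and>
     degree (label T) = Max (degree ` leaf_labels T) \<and>
     (\<forall>v\<in>nodes T. children v \<noteq> [] \<and> degree (label v) = degree (label T) \<longrightarrow>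
        (let P = label ` set (children v) - {0} in
           (\<forall>p\<in>P. degree p = degree (label T) \<or> degree p + 1 = degree (label T)) \<and>
           common_interlacing P))"

end

theory Submission
  imports Defs
begin

text \<open>
  Fix a node whose label \<open>p\<close> has the full degree \<open>n\<close>, and let \<open>f\<close> be a common interlacing of
  its nonzero children. The \<open>n\<close>-th largest root \<open>a\<close> of \<open>f\<close> separates the smallest root of every
  child of degree \<open>n\<close> from the other roots of that child, whereas every child of degree \<open>n - 1\<close> has
  all its roots at or above \<open>a\<close>. So, after multiplication by \<open>(-1) ^ n\<close>, a child of degree \<open>n\<close> is
  nonpositive between its smallest root and \<open>a\<close>, and a child of degree \<open>n - 1\<close> is nonpositive
  everywhere up to \<open>a\<close> (\<open>signed_value_nonpos\<close>).

  Let \<open>b\<close> be the largest among the smallest roots of the children of degree \<open>n\<close>. Then all children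
  are nonpositive at \<open>b\<close> in this sense, hence so is their convex combination \<open>p\<close>. A real-rooted
  polynomial of degree \<open>n\<close> with all roots above \<open>b\<close> would be positive there, so \<open>p\<close> has a root
  at or below \<open>b\<close>: the child attaining \<open>b\<close> has full degree and a minimal root at least that of \<open>p\<close>
  (\<open>child_with_larger_minroot\<close>). Descending in this way from the root of the tree ends at the
  desired leaf.
\<close>

section \<open>Factorization of real-rooted polynomials\<close>

lemma map_poly_of_real_mult:
  "map_poly complex_of_real (p * q) = map_poly complex_of_real p * map_poly complex_of_real q"
  by (rule poly_eqI) (simp add: coeff_mult coeff_map_poly)

lemma poly_map_poly_of_real:
  "poly (map_poly complex_of_real p) (complex_of_real x) = complex_of_real (poly p x)"
  by (induction p) (simp_all add: map_poly_pCons)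

lemma real_rooted_imp_root:
  assumes "real_rooted p" and "degree p > 0"
  obtains x where "poly p x = 0"
proof -
  have "degree (map_poly complex_of_real p) = degree p"
    by (simp add: degree_map_poly)
  then have "\<not> constant (poly (map_poly complex_of_real p))"
    using assms(2) by (simp add: constant_degree)
  then obtain z where z: "poly (map_poly complex_of_real p) z = 0"
    using fundamental_theorem_of_algebra by blast
  then have "z \<in> \<real>"
    using assms(1) by (auto simp: real_rooted_def)
  then obtain x where "z = complex_of_real x"
    by (auto elim: Reals_cases)
  then show thesis
    using z that by (simp add: poly_map_poly_of_real)
qed

lemma real_rooted_factor:
  assumes "real_rooted (p * q)"
  shows "real_rooted q"
  using assms by (auto simp: real_rooted_def map_poly_of_real_mult)

lemma real_rooted_factorization:
  assumes "real_rooted p"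
  shows "p = smult (lead_coeff p) (\<Prod>r\<in>#proots p. [:-r, 1:])" and "size (proots p) = degree p"
proof -
  have "p = smult (lead_coeff p) (\<Prod>r\<in>#proots p. [:-r, 1:]) \<and> size (proots p) = degree p"
    using assms
  proof (induction "degree p" arbitrary: p)
    case 0
    then obtain c where "p = [:c:]"
      by (metis degree_eq_zeroE)
    then show ?case
      by simp
  next
    case (Suc n)
    then obtain x where "poly p x = 0"
      using real_rooted_imp_root by (metis zero_less_Suc)
    then obtain q where p: "p = [:-x, 1:] * q"
      by (auto simp: poly_eq_0_iff_dvd)
    have q: "real_rooted q"
      using Suc.prems unfolding p by (rule real_rooted_factor)
    then have "q \<noteq> 0"
      by (simp add: real_rooted_def)
    then have deg: "degree p = Suc (degree q)"
      unfolding p by (subst degree_mult_eq) auto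
    have roots: "proots p = add_mset x (proots q)"
      using \<open>q \<noteq> 0\<close> unfolding p by (subst proots_mult) auto
    have lc: "lead_coeff p = lead_coeff q"
      unfolding p by (simp only: lead_coeff_mult) simp
    have IH: "q = smult (lead_coeff q) (\<Prod>r\<in>#proots q. [:-r, 1:])" "size (proots q) = degree q"
      using Suc.hyps(1)[of q] Suc.hyps(2) deg q by auto
    have "smult (lead_coeff p) (\<Prod>r\<in>#proots p. [:-r, 1:])
        = [:-x, 1:] * smult (lead_coeff q) (\<Prod>r\<in>#proots q. [:-r, 1:])"
      unfolding lc roots by (simp only: image_mset_add_mset prod_mset.add_mset mult_smult_right)
    also have "\<dots> = p"
      using IH(1) p by simp
    finally show ?case
      using IH(2) deg roots by simp
  qed
  then show "p = smult (lead_coeff p) (\<Prod>r\<in>#proots p. [:-r, 1:])" "size (proots p) = degree p"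
    by auto
qed

text \<open>
  The factor \<open>(-1) ^ degree p\<close> normalizes the sign so that values below all roots come out positive
  when the leading coefficient is.
\<close>

lemma signed_value_factorization:
  assumes "real_rooted p"
  shows "(-1) ^ degree p * poly p x = lead_coeff p * (\<Prod>r\<in>#proots p. r - x)"
proof -
  have prod: "(-1) ^ size A * poly (\<Prod>r\<in>#A. [:-r, 1:]) x = (\<Prod>r\<in>#A. r - x)" for A :: "real multiset"
  proof (induction A)
    case (add r A)
    have "(-1) ^ size (add_mset r A) * poly (\<Prod>r\<in>#add_mset r A. [:-r, 1:]) x
        = (r - x) * ((-1) ^ size A * poly (\<Prod>r\<in>#A. [:-r, 1:]) x)"
      by (simp add: algebra_simps)
    then show ?case
      by (simp add: add.IH)
  qed simp
  have "poly p x = lead_coeff p * poly (\<Prod>r\<in>#proots p. [:-r, 1:]) x"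
    by (subst real_rooted_factorization(1)[OF assms]) (simp only: poly_smult)
  then have "(-1) ^ degree p * poly p x
      = lead_coeff p * ((-1) ^ size (proots p) * poly (\<Prod>r\<in>#proots p. [:-r, 1:]) x)"
    by (simp add: real_rooted_factorization(2)[OF assms])
  then show ?thesis
    by (simp only: prod)
qed

lemma prod_mset_nonneg:
  fixes h :: "real \<Rightarrow> real"
  assumes "\<forall>r\<in>#A. h r \<ge> 0"
  shows "(\<Prod>r\<in>#A. h r) \<ge> 0"
  using assms by (induction A) auto

lemma prod_mset_pos:
  fixes h :: "real \<Rightarrow> real"
  assumes "\<forall>r\<in>#A. h r > 0"
  shows "(\<Prod>r\<in>#A. h r) > 0"
  using assms by (induction A) auto

text \<open>
  If all roots exceeded \<open>x\<close>, every factor of the signed value at \<open>x\<close> would be positive. Because the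
  polynomial splits over the reals, this gives a root at or below \<open>x\<close> without a limit at \<open>-\<infinity>\<close> and the
  intermediate value theorem.
\<close>

lemma minroot_le_of_signed_value_nonpos:
  assumes "real_rooted p" and "lead_coeff p > 0" and "(-1) ^ degree p * poly p x \<le> 0"
  shows "minroot p \<le> x"
proof -
  have "p \<noteq> 0"
    using assms(1) by (simp add: real_rooted_def)
  have "(\<Prod>r\<in>#proots p. r - x) \<le> 0"
    using assms(2,3) unfolding signed_value_factorization[OF assms(1)] by (simp add: mult_le_0_iff)
  then have "\<not> (\<forall>r\<in>#proots p. r - x > 0)"
    using prod_mset_pos[of "proots p" "\<lambda>r. r - x"] by linarith
  then obtain r where r: "poly p r = 0" "r \<le> x"
    using \<open>p \<noteq> 0\<close> by auto
  have "minroot p \<le> r"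
    unfolding minroot_def using r(1) poly_roots_finite[OF \<open>p \<noteq> 0\<close>] by (intro Min_le) auto
  then show ?thesis
    using r(2) by simp
qed

section \<open>Location of the roots under a common interlacing\<close>

lemma ith_largest_root_eq_nth:
  assumes "real_rooted p" and "1 \<le> i" and "i \<le> degree p"
  shows "ith_largest_root p i = sorted_list_of_multiset (proots p) ! (degree p - i)"
proof -
  have "length (sorted_list_of_multiset (proots p)) = degree p"
    using real_rooted_factorization(2)[OF assms(1)]
    by (metis mset_sorted_list_of_multiset size_mset)
  then show ?thesis
    using assms(2,3) by (simp add: ith_largest_root_def rev_nth)
qed

text \<open>
  Only one copy of the minimal root is split off, so that \<open>A\<close> contains it again when it is multiple.
  The conjunct \<open>degree p \<ge> 2\<close> records that the index \<open>degree p - 1\<close> is a legitimate one as soon as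
  there is a further root.
\<close>

lemma proots_split_minroot:
  assumes "real_rooted p" and "degree p > 0"
  obtains A where "proots p = add_mset (minroot p) A"
    and "minroot p = ith_largest_root p (degree p)"
    and "\<forall>r\<in>#A. degree p \<ge> 2 \<and> ith_largest_root p (degree p - 1) \<le> r"
proof -
  define xs where "xs = sorted_list_of_multiset (proots p)"
  have "p \<noteq> 0"
    using assms(1) by (simp add: real_rooted_def)
  have len: "length xs = degree p"
    using real_rooted_factorization(2)[OF assms(1)]
    unfolding xs_def by (metis mset_sorted_list_of_multiset size_mset)
  obtain y ys where xs: "xs = y # ys"
    using len assms(2) by (cases xs) auto
  have sorted: "sorted (y # ys)"
    unfolding xs[symmetric] xs_def by simp
  have roots: "proots p = add_mset y (mset ys)"
    using xs unfolding xs_def by (metis mset.simps(2) mset_sorted_list_of_multiset)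
  have "{x. poly p x = 0} = set (y # ys)"
    using set_count_proots[OF \<open>p \<noteq> 0\<close>] roots by simp
  then have y: "minroot p = y"
    unfolding minroot_def using sorted by (auto intro!: Min_eqI)
  have "ith_largest_root p (degree p) = y"
    using ith_largest_root_eq_nth[OF assms(1), of "degree p"] assms(2) xs
    by (simp add: xs_def[symmetric])
  moreover have "degree p \<ge> 2 \<and> ith_largest_root p (degree p - 1) \<le> r" if r: "r \<in> set ys" for r
  proof -
    obtain z zs where ys: "ys = z # zs"
      using r by (cases ys) auto
    then have two: "degree p \<ge> 2"
      using len xs by auto
    then have "ith_largest_root p (degree p - 1) = z"
      using ith_largest_root_eq_nth[OF assms(1), of "degree p - 1"] xs ys
      by (simp add: xs_def[symmetric])
    then show ?thesis
      using two sorted ys r by auto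
  qed
  ultimately show thesis
    using roots y by (intro that[of "mset ys"]) simp_all
qed

text \<open>
  An interlacing polynomial of a polynomial of degree \<open>n\<close> has degree \<open>n\<close> or \<open>n + 1\<close>; in either case
  it is its \<open>n\<close>-th largest root that lies between the smallest root and the second smallest one.
\<close>

lemma interlaces_same_degree_split:
  assumes "interlaces f p" and "degree p = n" and "n \<ge> 1"
  obtains A where "proots p = add_mset (minroot p) A"
    and "minroot p \<le> ith_largest_root f n"
    and "\<forall>r\<in>#A. ith_largest_root f n \<le> r"
proof -
  have "real_rooted p" "degree p > 0"
    using assms by (auto simp: interlaces_def)
  then obtain A where A: "proots p = add_mset (minroot p) A"
    "minroot p = ith_largest_root p n"
    "\<forall>r\<in>#A. n \<ge> 2 \<and> ith_largest_root p (n - 1) \<le> r"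
    using proots_split_minroot assms(2) by metis
  have "ith_largest_root p n \<le> ith_largest_root f n"
    using assms by (auto simp: interlaces_def)
  moreover have "ith_largest_root f n \<le> ith_largest_root p (n - 1)" if "n \<ge> 2"
  proof -
    have "n - 1 \<in> {1..<degree f}" "n - 1 + 1 = n"
      using that assms by (auto simp: interlaces_def)
    then show ?thesis
      using assms(1) unfolding interlaces_def by metis
  qed
  ultimately show thesis
    using that[of A] A by force
qed

lemma interlaces_lower_degree_roots_ge:
  assumes "interlaces f p" and "degree f = n" and "degree p + 1 = n" and "r \<in># proots p"
  shows "ith_largest_root f n \<le> r"
proof -
  have rr: "real_rooted p"
    using assms(1) by (auto simp: interlaces_def)
  have pos: "degree p > 0"
    using real_rooted_factorization(2)[OF rr] assms(4) by (cases "degree p") auto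
  obtain A where A: "proots p = add_mset (minroot p) A"
    "minroot p = ith_largest_root p (degree p)"
    using proots_split_minroot[OF rr pos] by metis
  have "p \<noteq> 0"
    using rr by (simp add: real_rooted_def)
  have "minroot p \<le> r"
    unfolding minroot_def using assms(4) poly_roots_finite[OF \<open>p \<noteq> 0\<close>] \<open>p \<noteq> 0\<close>
    by (intro Min_le) auto
  moreover have "degree p \<in> {1..<degree f}"
    using pos assms(2,3) by auto
  then have "ith_largest_root f (degree p + 1) \<le> ith_largest_root p (degree p)"
    using assms(1-3) unfolding interlaces_def by fastforce
  ultimately show ?thesis
    using A(2) assms(3) by simp
qed

text \<open>
  In the first case \<open>minroot p - x\<close> is nonpositive and all other factors \<open>r - x\<close> are nonnegative.
  In the second case all factors are nonnegative, but \<open>(-1) ^ n\<close> differs by one sign from the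
  normalization \<open>(-1) ^ degree p\<close>.
\<close>

lemma signed_value_nonpos:
  assumes "interlaces f p" and "n \<ge> 1"
    and "degree p = n \<and> minroot p \<le> x \<or> degree p + 1 = n \<and> degree f = n"
    and "x \<le> ith_largest_root f n"
  shows "(-1) ^ n * poly p x \<le> 0"
proof -
  have rr: "real_rooted p" and lc: "lead_coeff p > 0"
    using assms(1) by (auto simp: interlaces_def)
  note fact = signed_value_factorization[OF rr, of x]
  show ?thesis
    using assms(3)
  proof
    assume deg: "degree p = n \<and> minroot p \<le> x"
    then obtain A where A: "proots p = add_mset (minroot p) A"
      "\<forall>r\<in>#A. ith_largest_root f n \<le> r"
      using interlaces_same_degree_split assms(1,2) by metis
    have "(\<Prod>r\<in>#A. r - x) \<ge> 0"
      using A(2) assms(4) by (intro prod_mset_nonneg) force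
    then have "(minroot p - x) * (\<Prod>r\<in>#A. r - x) \<le> 0"
      using deg by (simp add: mult_nonpos_nonneg)
    then have "lead_coeff p * (\<Prod>r\<in>#proots p. r - x) \<le> 0"
      using lc unfolding A(1) by (simp add: mult_nonneg_nonpos)
    then show ?thesis
      using fact deg by simp
  next
    assume deg: "degree p + 1 = n \<and> degree f = n"
    have "(\<Prod>r\<in>#proots p. r - x) \<ge> 0"
      using interlaces_lower_degree_roots_ge[OF assms(1)] deg assms(4)
      by (intro prod_mset_nonneg) force
    then have "(-1) ^ degree p * poly p x \<ge> 0"
      unfolding fact using lc by (intro mult_nonneg_nonneg) auto
    moreover have "n = Suc (degree p)"
      using deg by simp
    ultimately show ?thesis
      by simp
  qed
qed

section \<open>Convex combinations and descent in the tree\<close>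

text \<open>
  The child is chosen to have the largest minimal root among all those of degree \<open>n\<close>, whatever its
  weight: at that point every single child has a nonpositive signed value.
\<close>

lemma child_with_larger_minroot:
  assumes conv: "convex_combination p ps"
    and rr: "real_rooted p" and lc: "lead_coeff p > 0"
    and deg: "degree p = n" and n: "n \<ge> 1"
    and degs: "\<forall>q\<in>set ps - {0}. degree q = n \<or> degree q + 1 = n"
    and common: "common_interlacing (set ps - {0})"
  shows "\<exists>q\<in>set ps. degree q = n \<and> minroot q \<ge> minroot p"
proof -
  obtain w where w: "\<forall>i<length ps. w i \<ge> (0::real)"
    and p: "p = (\<Sum>i<length ps. smult (w i) (ps ! i))"
    using conv by (auto simp: convex_combination_def)
  obtain f where f: "\<forall>q\<in>set ps - {0}. interlaces f q"
    using common by (auto simp: common_interlacing_def)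
  define B where "B = {q \<in> set ps. degree q = n}"
  have "B \<noteq> {}"
  proof
    \<comment> \<open>Otherwise the combination could not reach degree \<open>n\<close>.\<close>
    assume "B = {}"
    then have "degree q \<le> n - 1" if "q \<in> set ps" for q
      using that degs by (cases "q = 0") (auto simp: B_def)
    then have "degree p \<le> n - 1"
      unfolding p by (intro degree_sum_le) (auto intro: order_trans[OF degree_smult_le])
    then show False
      using deg n by simp
  qed
  moreover have "finite B"
    by (simp add: B_def)
  ultimately have fin: "finite (minroot ` B)" "minroot ` B \<noteq> {}"
    by auto
  obtain q where q: "q \<in> B" and max: "minroot q = Max (minroot ` B)"
    using Max_in[OF fin] by (metis imageE)
  have q_int: "interlaces f q" "degree q = n" "q \<in> set ps"
    using q f n by (auto simp: B_def)
  have below: "minroot q \<le> ith_largest_root f n"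
    using interlaces_same_degree_split[OF q_int(1,2) n] by metis
  have nonpos: "(-1) ^ n * poly r (minroot q) \<le> 0" if r: "r \<in> set ps" for r
  proof (cases "r = 0")
    case False
    then have r_int: "interlaces f r"
      using f r by auto
    have "degree r = n \<and> minroot r \<le> minroot q \<or> degree r + 1 = n \<and> degree f = n"
    proof (cases "degree r = n")
      case True
      then show ?thesis
        using r max fin(1) by (simp add: B_def)
    next
      case neq: False
      then have "degree r + 1 = n"
        using degs False r by auto
      \<comment> \<open>The degree of \<open>f\<close> exceeds that of \<open>r\<close> by at most one and is at least that of \<open>q\<close>.\<close>
      then show ?thesis
        using r_int q_int(1,2) by (auto simp: interlaces_def)
    qed
    then show ?thesis
      using signed_value_nonpos[OF r_int n] below by blast
  qed simp
  have "(-1) ^ n * poly p (minroot q)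
      = (\<Sum>i<length ps. w i * ((-1) ^ n * poly (ps ! i) (minroot q)))"
    unfolding p by (simp add: poly_sum sum_distrib_left mult.left_commute)
  also have "\<dots> \<le> 0"
    using w nonpos by (intro sum_nonpos mult_nonneg_nonpos[OF _ nonpos]) simp_all
  finally have "minroot p \<le> minroot q"
    using minroot_le_of_signed_value_nonpos[OF rr lc] deg by simp
  then show ?thesis
    using q_int by blast
qed

lemma self_in_nodes: "v \<in> nodes v"
  by (cases v) simp

lemma nodes_trans: "u \<in> nodes v \<Longrightarrow> v \<in> nodes T \<Longrightarrow> u \<in> nodes T"
  by (induction T rule: nodes.induct) auto

lemma child_in_nodes: "u \<in> set (children v) \<Longrightarrow> u \<in> nodes v"
  by (cases v) (auto intro: self_in_nodes)

text \<open>
  The chosen child again has full degree, which is what makes the common interlacing available at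
  the next step of the descent.
\<close>

lemma leaf_with_larger_minroot:
  assumes tree: "generalized_interlacing_tree T" and n: "degree (label T) \<ge> 1"
    and "v \<in> nodes T" and "degree (label v) = degree (label T)"
  shows "\<exists>p\<in>leaf_labels T. degree p = degree (label T) \<and> minroot p \<ge> minroot (label v)"
proof -
  from tree have T:
    "\<forall>v\<in>nodes T. label v = 0 \<or> real_rooted (label v) \<and> lead_coeff (label v) > 0"
    "\<forall>v\<in>nodes T. children v \<noteq> [] \<longrightarrow> convex_combination (label v) (map label (children v))"
    "\<forall>v\<in>nodes T. children v \<noteq> [] \<and> degree (label v) = degree (label T) \<longrightarrow>
       (let P = label ` set (children v) - {0} in
          (\<forall>p\<in>P. degree p = degree (label T) \<or> degree p + 1 = degree (label T)) \<and>
          common_interlacing P)"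
    unfolding generalized_interlacing_tree_def by blast+
  show ?thesis
    using assms(3,4)
  proof (induction v)
    case (Node a ts)
    show ?case
    proof (cases "ts = []")
      case True
      then have "a \<in> leaf_labels T"
        using Node.prems(1) unfolding leaf_labels_def by force
      then show ?thesis
        using Node.prems(2) by auto
    next
      case False
      have "a \<noteq> 0"
        using Node.prems(2) n by auto
      then have a: "real_rooted a" "lead_coeff a > 0"
        using bspec[OF T(1) Node.prems(1)] by simp_all
      have conv: "convex_combination a (map label ts)"
        using bspec[OF T(2) Node.prems(1)] False by simp
      have P: "\<forall>q\<in>set (map label ts) - {0}. degree q = degree (label T) \<or> degree q + 1 = degree (label T)"
        "common_interlacing (set (map label ts) - {0})"
        using bspec[OF T(3) Node.prems(1)] Node.prems(2) False
        by (auto simp only: Let_def rose_tree.sel set_map)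
      obtain u where u: "u \<in> set ts" "degree (label u) = degree (label T)"
        "minroot a \<le> minroot (label u)"
        using child_with_larger_minroot[OF conv a _ n P] Node.prems(2) by auto
      have "u \<in> nodes T"
        using u(1) nodes_trans[OF child_in_nodes Node.prems(1)] by simp
      then show ?thesis
        using Node.IH[OF u(1) _ u(2)] u(3) by fastforce
    qed
  qed
qed

theorem theorem3p2:
  fixes f :: "nat \<Rightarrow> real poly" and m :: nat and T :: "real poly rose_tree"
  assumes "generalized_interlacing_tree T"
    and "f ` {1..m} = leaf_labels T"
    and "degree (label T) \<ge> 1"
  shows "\<exists>j\<in>{1..m}. degree (f j) = degree (label T) \<and> minroot (f j) \<ge> minroot (label T)"
proof -
  obtain p where "p \<in> f ` {1..m}" "degree p = degree (label T)" "minroot p \<ge> minroot (label T)"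
    using leaf_with_larger_minroot[OF assms(1,3) self_in_nodes refl] assms(2) by auto
  then show ?thesis
    by auto
qed

end
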